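(* Let $\ell$ be an odd prime, let $\sigma=\frac{\ell}{2}\,(\ell E_2(q^\ell)-E_2(q))$, and let $U=U(X,Y,Z)$ be the Charlap-Coley-Robbins polynomial for $\ell$ written in terms of $E_4,E_6$, so that $U(\sigma,E_4,E_6)=0$. Put $\tilde E_6=E_6(q^\ell)$. Let $\partial_\sigma,\partial_4,\partial_6$ denote the first partial derivatives of $U$ with respect to its first, second and third variable, and $\partial_{\sigma\sigma},\partial_{\sigma4},\partial_{\sigma6},\partial_{44},\partial_{46},\partial_{66}$ the corresponding second partial derivatives, all evaluated at $(\sigma,E_4,E_6)$. Then $$\tilde E_6=-\,\frac{N}{\ell^6\,\partial_\sigma^3},$$ where $$N=-E_6\,\partial_\sigma^3\,\ell^3+c_2\,\ell^2+12\,\partial_\sigma^2\,\sigma\,(3E_4^2\,\partial_6+2E_6\,\partial_4)\,\ell-8\,\partial_\sigma^3\,\sigma^3$$ and $$\begin{aligned} c_2={}&18\,(\partial_6^2\partial_{\sigma\sigma}-2\partial_6\partial_\sigma\partial_{\sigma6}+\partial_{66}\partial_\sigma^2)\,E_4^4\\ &+\bigl(24E_6\partial_4(\partial_6\partial_{\sigma\sigma}-\partial_\sigma\partial_{\sigma6})+24E_6\partial_\sigma(\partial_{46}\partial_\sigma-\partial_6\partial_{\sigma4})+10\,\partial_4\partial_\sigma^2\bigr)\,E_4^2\\ &+3\,\partial_\sigma^2\,(7E_6\partial_6-\sigma\partial_\sigma)\,E_4\\ &+8E_6^2\,(\partial_4^2\partial_{\sigma\sigma}-2\partial_4\partial_\sigma\partial_{\sigma4}+\partial_{44}\partial_\sigma^2).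 \end{aligned}$$
   Context: Here $q=\exp(2i\pi\tau)$, and $E_2(q)=1-24\sum_{n\ge1}\delta_1(n)q^n$, $E_4(q)=1+240\sum_{n\ge1}\delta_3(n)q^n$, $E_6(q)=1-504\sum_{n\ge1}\delta_5(n)q^n$, where $\delta_r(n)$ is the sum of the $r$-th powers of the divisors of $n$. We abbreviate $E_k=E_k(q)$ and $\tilde E_k=E_k(q^\ell)$. The Charlap-Coley-Robbins (CCR) polynomial $U_\ell(X,A,B)\in\mathbb{Z}[X,A,B,1/\ell]$ is the polynomial, monic of degree $\ell+1$ in $X$, with $U_\ell(\sigma,A,B)=0$ for $A=-3E_4$, $B=-2E_6$ (it is the minimal polynomial of $\sigma$ over $\mathbb{Q}(E_4,E_6)$). We write $U(X,Y,Z)=U_\ell(X,-3Y,-2Z)$, so that $U(\sigma,E_4,E_6)=0$. Assigning weights $1,2,3$ to $X,Y,Z$, the polynomial $U$ is weighted homogeneous of degree $\ell+1$. The identity is one of (quotients of) power series in $q$; $\partial_\sigma$ is a nonzero series since $U$ is the minimal polynomial of $\sigma$. *)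

theory Defs
  imports "HOL-Computational_Algebra.Computational_Algebra"
begin

(* Eisenstein series are formal Laurent series in q over the rationals. All series in question are
   power series; Laurent series are used because they form a field, so quotients are genuine. *)

definition divisor_power_sum :: "nat \<Rightarrow> nat \<Rightarrow> nat" where
  "divisor_power_sum r n = (\<Sum>d | d dvd n. d ^ r)"

definition eisenstein_series :: "rat \<Rightarrow> nat \<Rightarrow> rat fls" where
  "eisenstein_series c r =
     fps_to_fls (Abs_fps (\<lambda>n. if n = 0 then 1 else c * of_nat (divisor_power_sum r n)))"

definition E2 :: "rat fls" where "E2 = eisenstein_series (- 24) 1"
definition E4 :: "rat fls" where "E4 = eisenstein_series 240 3"
definition E6 :: "rat fls" where "E6 = eisenstein_series (- 504) 5"

definition sigma_series :: "nat \<Rightarrow> rat fls" where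
  "sigma_series l = (of_nat l / 2) * (of_nat l * fls_compose_power E2 l - E2)"


(* A polynomial in X, Y, Z over the rationals is a nested univariate polynomial: X is the outermost
   variable and Z the innermost one, so that coeff (coeff (coeff P i) j) k is the coefficient
   of X^i Y^j Z^k. *)

type_synonym poly3 = "rat poly poly poly"

definition eval1 :: "rat poly \<Rightarrow> rat fls \<Rightarrow> rat fls" where
  "eval1 p z = poly (map_poly fls_const p) z"

definition eval2 :: "rat poly poly \<Rightarrow> rat fls \<Rightarrow> rat fls \<Rightarrow> rat fls" where
  "eval2 p y z = poly (map_poly (\<lambda>c. eval1 c z) p) y"

definition specialize_YZ :: "poly3 \<Rightarrow> rat fls \<Rightarrow> rat fls \<Rightarrow> rat fls poly" where
  "specialize_YZ P y z = map_poly (\<lambda>c. eval2 c y z) P"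

definition eval3 :: "poly3 \<Rightarrow> rat fls \<Rightarrow> rat fls \<Rightarrow> rat fls \<Rightarrow> rat fls" where
  "eval3 P x y z = poly (specialize_YZ P y z) x"

definition pderiv_X :: "poly3 \<Rightarrow> poly3" where "pderiv_X = pderiv"
definition pderiv_Y :: "poly3 \<Rightarrow> poly3" where "pderiv_Y = map_poly pderiv"
definition pderiv_Z :: "poly3 \<Rightarrow> poly3" where "pderiv_Z = map_poly (map_poly pderiv)"

definition weighted_homogeneous :: "nat \<Rightarrow> nat \<Rightarrow> nat \<Rightarrow> nat \<Rightarrow> poly3 \<Rightarrow> bool" where
  "weighted_homogeneous a b c n P \<longleftrightarrow>
     (\<forall>i j k. coeff (coeff (coeff P i) j) k \<noteq> 0 \<longrightarrow> a * i + b * j + c * k = n)"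


definition is_subfield :: "'a::field set \<Rightarrow> bool" where
  "is_subfield K \<longleftrightarrow> 0 \<in> K \<and> 1 \<in> K \<and>
     (\<forall>x\<in>K. \<forall>y\<in>K. x - y \<in> K \<and> x * y \<in> K \<and> x / y \<in> K)"

(* For S in a field of characteristic 0 this is the field generated by S over the rationals. *)
definition generated_subfield :: "'a::field set \<Rightarrow> 'a set" where
  "generated_subfield S = \<Inter>{K. is_subfield K \<and> S \<subseteq> K}"

definition is_minimal_polynomial :: "'a::field set \<Rightarrow> 'a \<Rightarrow> 'a poly \<Rightarrow> bool" where
  "is_minimal_polynomial K x p \<longleftrightarrow>
     (\<forall>i. coeff p i \<in> K) \<and> lead_coeff p = 1 \<and> poly p x = 0 \<and>
     (\<forall>r. (\<forall>i. coeff r i \<in> K) \<and> r \<noteq> 0 \<and> poly r x = 0 \<longrightarrow> degree p \<le> degree r)"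


(* U(X, Y, Z) = P(X, -3 Y, -2 Z) *)
definition rescale_ccr :: "poly3 \<Rightarrow> poly3" where
  "rescale_ccr P =
     map_poly (\<lambda>p. pcompose (map_poly (\<lambda>r. pcompose r [:0, - 2:]) p) [:0, - 3:]) P"

(* P is the Charlap-Coley-Robbins polynomial U_l(X, A, B). Being the minimal polynomial of sigma
   over Q(E4, E6) is what singles P out, as E4 and E6 are algebraically independent; weighted
   homogeneity reflects that sigma, E4, E6 are modular forms of weights 2, 4, 6, and is recorded
   here as one of the standing properties of the polynomial. *)
definition is_ccr_polynomial :: "nat \<Rightarrow> poly3 \<Rightarrow> bool" where
  "is_ccr_polynomial l P \<longleftrightarrow>
     (\<forall>i j k. \<exists>m. coeff (coeff (coeff P i) j) k * of_nat l ^ m \<in> \<int>) \<and>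
     lead_coeff P = 1 \<and> degree P = l + 1 \<and>
     eval3 P (sigma_series l) (- 3 * E4) (- 2 * E6) = 0 \<and>
     is_minimal_polynomial (generated_subfield {E4, E6}) (sigma_series l)
       (specialize_YZ P (- 3 * E4) (- 2 * E6)) \<and>
     weighted_homogeneous 1 2 3 (l + 1) (rescale_ccr P)"

end

theory Submission
  imports Defs
begin

text \<open>
  With \<open>D = q d/dq\<close>, Ramanujan's identities express \<open>D E2\<close>, \<open>D E4\<close>, \<open>D E6\<close> through \<open>E2\<close>, \<open>E4\<close>, \<open>E6\<close>,
  and likewise at \<open>q\<^sup>l\<close>. Differentiating \<open>U(\<sigma>, E4, E6) = 0\<close> once expresses \<open>E4(q\<^sup>l)\<close>, and
  differentiating a second time expresses \<open>E6(q\<^sup>l)\<close>. All occurrences of \<open>E2\<close> cancel because of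
  Euler's relations for the weighted homogeneous polynomial \<open>U\<close> and its partial derivatives.

  Ramanujan's identities are convolution identities for divisor sums, proved after Skoruppa: the
  maps \<open>(a, b, x, y) \<mapsto> (a, a + b, x - y, y)\<close> and \<open>(a, b, x, y) \<mapsto> (a + b, b, x, y - x)\<close> preserve
  \<open>a x + b y\<close>, so that for \<open>h\<close> with \<open>h(a, b - a) = h(a - b, b)\<close> the sum of
  \<open>h(a, b) - h(a, b - a)\<close> over the positive solutions of \<open>a x + b y = n\<close> reduces to the
  degenerate terms \<open>x = y\<close> and \<open>a = b\<close>. Powers of \<open>a\<^sup>2 + a b + b\<^sup>2\<close> and \<open>(a b (a + b))\<^sup>2\<close> are such
  functions, and their differences are combinations of the required monomials.
\<close>

section \<open>Convolution sums of divisor functions\<close>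

definition lattice_reps :: "nat \<Rightarrow> (nat \<times> nat \<times> nat \<times> nat) set" where
  "lattice_reps n = {(a, b, x, y). 0 < a \<and> 0 < b \<and> 0 < x \<and> 0 < y \<and> a * x + b * y = n}"

lemma finite_lattice_reps [simp]: "finite (lattice_reps n)"
proof (rule finite_subset)
  show "lattice_reps n \<subseteq> {..n} \<times> {..n} \<times> {..n} \<times> {..n}"
  proof (clarsimp simp: lattice_reps_def)
    fix a b x y :: nat assume "0 < a" "0 < b" "0 < x" "0 < y"
    then have "a * 1 \<le> a * x" "1 * x \<le> a * x" "b * 1 \<le> b * y" "1 * y \<le> b * y"
      by (auto intro!: mult_le_mono)
    then show "a \<le> a * x + b * y \<and> b \<le> a * x + b * y \<and> x \<le> a * x + b * y \<and> y \<le> a * x + b * y"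
      by linarith
  qed
qed simp

text \<open>Since a (x - y) + (a + b) y = a x + b y, the map \<open>j\<close> carries the solutions
  with y < x onto those with a < b. The difference \<open>of_nat b - of_nat a\<close> is formed in
  the ring because the full sum will also contain negative differences.\<close>

lemma sum_lattice_reps_x_gt_y:
  fixes h :: "'a::comm_ring_1 \<Rightarrow> 'a \<Rightarrow> 'a"
  shows "(\<Sum>(a, b, x, y) \<in> {(a, b, x, y) \<in> lattice_reps n. y < x}. h (of_nat a) (of_nat b))
       = (\<Sum>(a, b, x, y) \<in> {(a, b, x, y) \<in> lattice_reps n. a < b}. h (of_nat a) (of_nat b - of_nat a))"
  by (rule sum.reindex_bij_witness[where i = "\<lambda>(a, b, x, y). (a, b - a, x + y, y)"
          and j = "\<lambda>(a, b, x, y). (a, a + b, x - y, y)"])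
     (auto simp: lattice_reps_def algebra_simps diff_mult_distrib2 trans_le_add1)

lemma sum_lattice_reps_x_less_y:
  fixes h :: "'a::comm_ring_1 \<Rightarrow> 'a \<Rightarrow> 'a"
  shows "(\<Sum>(a, b, x, y) \<in> {(a, b, x, y) \<in> lattice_reps n. x < y}. h (of_nat a) (of_nat b))
       = (\<Sum>(a, b, x, y) \<in> {(a, b, x, y) \<in> lattice_reps n. b < a}. h (of_nat a - of_nat b) (of_nat b))"
  by (rule sum.reindex_bij_witness[where i = "\<lambda>(a, b, x, y). (a - b, b, x, x + y)"
          and j = "\<lambda>(a, b, x, y). (a + b, b, x, y - x)"])
     (auto simp: lattice_reps_def algebra_simps diff_mult_distrib2 trans_le_add1)

text \<open>For x = y the equation reads (a + b) x = n: d = a + b divides n, x is the cofactor, and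
  a runs through 0 < a < d.\<close>

lemma sum_lattice_reps_x_eq_y:
  fixes h :: "'a::comm_ring_1 \<Rightarrow> 'a \<Rightarrow> 'a"
  assumes "n > 0"
  shows "(\<Sum>(a, b, x, y) \<in> {(a, b, x, y) \<in> lattice_reps n. x = y}. h (of_nat a) (of_nat b))
       = (\<Sum>d | d dvd n. \<Sum>a\<in>{0<..<d}. h (of_nat a) (of_nat d - of_nat a))"
proof -
  have "(\<Sum>(a, b, x, y) \<in> {(a, b, x, y) \<in> lattice_reps n. x = y}. h (of_nat a) (of_nat b))
      = (\<Sum>(d, a) \<in> (SIGMA d:{d. d dvd n}. {0<..<d}). h (of_nat a) (of_nat d - of_nat a))"
    by (rule sum.reindex_bij_witness[where i = "\<lambda>(d, a). (a, d - a, n div d, n div d)"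
          and j = "\<lambda>(a, b, x, y). (a + b, a)"])
       (use assms in \<open>auto simp: lattice_reps_def simp flip: add_mult_distrib intro: Nat.gr0I\<close>)
  then show ?thesis
    using assms by (simp add: sum.Sigma)
qed

text \<open>For a = b = d the equation reads d (x + y) = n, which leaves n/d - 1 choices for
  x.\<close>

lemma sum_lattice_reps_a_eq_b:
  fixes h :: "'a::comm_ring_1 \<Rightarrow> 'a \<Rightarrow> 'a"
  assumes "n > 0"
  shows "(\<Sum>(a, b, x, y) \<in> {(a, b, x, y) \<in> lattice_reps n. a = b}. h (of_nat a) (of_nat b - of_nat a))
       = (\<Sum>d | d dvd n. of_nat (n div d - 1) * h (of_nat d) 0)"
proof -
  have "(\<Sum>(a, b, x, y) \<in> {(a, b, x, y) \<in> lattice_reps n. a = b}. h (of_nat a) (of_nat b - of_nat a))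
      = (\<Sum>(d, x) \<in> (SIGMA d:{d. d dvd n}. {0<..<n div d}). h (of_nat d) 0)"
    by (rule sum.reindex_bij_witness[where i = "\<lambda>(d, x). (d, d, x, n div d - x)"
          and j = "\<lambda>(a, b, x, y). (a, x)"])
       (use assms in \<open>auto simp: lattice_reps_def simp flip: add_mult_distrib2 intro: Nat.gr0I\<close>)
  also have "\<dots> = (\<Sum>d | d dvd n. \<Sum>x\<in>{0<..<n div d}. h (of_nat d) 0)"
    using assms by (subst sum.Sigma) auto
  finally show ?thesis
    by simp
qed

text \<open>The sum of h(a, b) is split by comparing x with y, that of h(a, b - a) by comparing a
  with b. The part y < x cancels against a < b, and x < y against b < a, the latter by
  \<open>inv\<close>.\<close>

lemma sum_lattice_reps_invariant:
  fixes h :: "'a::comm_ring_1 \<Rightarrow> 'a \<Rightarrow> 'a"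
  assumes inv: "\<And>a b. h a (b - a) = h (a - b) b" and "n > 0"
  shows "(\<Sum>(a, b, x, y) \<in> lattice_reps n. h (of_nat a) (of_nat b) - h (of_nat a) (of_nat b - of_nat a))
       = (\<Sum>d | d dvd n. (\<Sum>a\<in>{0<..<d}. h (of_nat a) (of_nat d - of_nat a))
            - of_nat (n div d - 1) * h (of_nat d) 0)"
proof -
  let ?S = "lattice_reps n"
  have split: "(\<Sum>z\<in>?S. F z) = (\<Sum>z\<in>{z\<in>?S. p z < q z}. F z) + (\<Sum>z\<in>{z\<in>?S. q z < p z}. F z)
      + (\<Sum>z\<in>{z\<in>?S. p z = q z}. F z)" for F :: "_ \<Rightarrow> 'a" and p q :: "_ \<Rightarrow> nat"
  proof -
    have "?S = ({z\<in>?S. p z < q z} \<union> {z\<in>?S. q z < p z}) \<union> {z\<in>?S. p z = q z}"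
      by auto
    then have "(\<Sum>z\<in>?S. F z) = (\<Sum>z\<in>({z\<in>?S. p z < q z} \<union> {z\<in>?S. q z < p z}) \<union> {z\<in>?S. p z = q z}. F z)"
      by simp
    also have "\<dots> = (\<Sum>z\<in>{z\<in>?S. p z < q z}. F z) + (\<Sum>z\<in>{z\<in>?S. q z < p z}. F z)
      + (\<Sum>z\<in>{z\<in>?S. p z = q z}. F z)"
      by (subst sum.union_disjoint; (subst sum.union_disjoint)?) auto
    finally show ?thesis .
  qed
  show ?thesis
    using split[of "\<lambda>(a, b, x, y). h (of_nat a) (of_nat b)" "\<lambda>(a, b, x, y). y" "\<lambda>(a, b, x, y). x"]
      split[of "\<lambda>(a, b, x, y). h (of_nat a) (of_nat b - of_nat a)" "\<lambda>(a, b, x, y). a" "\<lambda>(a, b, x, y). b"]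
      sum_lattice_reps_x_gt_y[of h n] sum_lattice_reps_x_less_y[of h n]
      sum_lattice_reps_x_eq_y[OF \<open>n > 0\<close>, of h] sum_lattice_reps_a_eq_b[OF \<open>n > 0\<close>, of h]
    by (simp add: sum_subtractf case_prod_unfold inv eq_commute[of "snd (snd (snd _))"])
qed

section \<open>Divisor convolutions as sums over solutions\<close>

definition divisor_convolution :: "nat \<Rightarrow> nat \<Rightarrow> nat \<Rightarrow> nat" where
  "divisor_convolution r s n = (\<Sum>i\<le>n. divisor_power_sum r i * divisor_power_sum s (n - i))"

text \<open>Every number divides \<open>0\<close>, and a sum over an infinite set is \<open>0\<close>.\<close>
lemma divisor_power_sum_0 [simp]: "divisor_power_sum r 0 = 0"
  by (simp add: divisor_power_sum_def)

text \<open>A term of the expanded convolution is a number i with a divisor a of i and a divisor b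
  of n - i. Their cofactors x and y complete it to a solution with i = a x.\<close>

lemma divisor_convolution_eq_sum_lattice_reps:
  "divisor_convolution r s n = (\<Sum>(a, b, x, y) \<in> lattice_reps n. a ^ r * b ^ s)"
proof -
  \<comment> \<open>The ends i = 0 and i = n drop out by \<open>divisor_power_sum_0\<close>.\<close>
  have "divisor_convolution r s n = (\<Sum>i\<in>{0<..<n}. divisor_power_sum r i * divisor_power_sum s (n - i))"
    unfolding divisor_convolution_def
    by (rule sum.mono_neutral_right) (auto simp: not_less)
  also have "\<dots> = (\<Sum>i\<in>{0<..<n}. \<Sum>(a, b)\<in>{a. a dvd i} \<times> {b. b dvd n - i}. a ^ r * b ^ s)"
    by (simp add: divisor_power_sum_def sum_product sum.cartesian_product)
  also have "\<dots> = (\<Sum>(i, a, b)\<in>(SIGMA i:{0<..<n}. {a. a dvd i} \<times> {b. b dvd n - i}). a ^ r * b ^ s)"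
    by (subst sum.Sigma) (auto simp: case_prod_unfold)
  also have "\<dots> = (\<Sum>(a, b, x, y) \<in> lattice_reps n. a ^ r * b ^ s)"
    by (rule sum.reindex_bij_witness[where i = "\<lambda>(a, b, x, y). (a * x, a, b)"
          and j = "\<lambda>(i, a, b). (a, b, i div a, (n - i) div b)"])
       (auto simp: lattice_reps_def dvd_div_eq_0_iff intro!: Nat.gr0I)
  finally show ?thesis .
qed

lemma divisor_convolution_commute: "divisor_convolution r s n = divisor_convolution s r n"
  unfolding divisor_convolution_def
  by (rule sum.reindex_bij_witness[where i = "\<lambda>i. n - i" and j = "\<lambda>i. n - i"]) auto

lemma of_nat_divisor_convolution:
  "(of_nat (divisor_convolution r s n) :: rat)
     = (\<Sum>(a, b, x, y) \<in> lattice_reps n. of_nat a ^ r * of_nat b ^ s)"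
  by (simp add: divisor_convolution_eq_sum_lattice_reps case_prod_unfold)

text \<open>This evaluates the contribution of a = b when h(d, 0) is a power of d. The factor n in
  it becomes the derivative in Ramanujan's identities.\<close>

lemma sum_divisors_complement:
  assumes "n > 0"
  shows "(\<Sum>d | d dvd n. of_nat (n div d - 1) * (of_nat d :: rat) ^ Suc r)
       = of_nat n * of_nat (divisor_power_sum r n) - of_nat (divisor_power_sum (Suc r) n)"
proof -
  have "of_nat (n div d - 1) * (of_nat d :: rat) ^ Suc r = of_nat n * of_nat d ^ r - of_nat d ^ Suc r"
    if "d dvd n" for d
    using that assms by (auto elim!: dvdE simp: of_nat_diff Suc_le_eq algebra_simps)
  then show ?thesis
    by (simp add: divisor_power_sum_def sum_distrib_left sum_subtractf)
qed

text \<open>Faulhaber's formulas with the upper end excluded, hence the negative second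
  coefficients.\<close>

lemma sum_powers:
  "(\<Sum>a<n. (of_nat a :: rat)) = of_nat n ^ 2 / 2 - of_nat n / 2"
  "(\<Sum>a<n. (of_nat a :: rat) ^ 2) = of_nat n ^ 3 / 3 - of_nat n ^ 2 / 2 + of_nat n / 6"
  "(\<Sum>a<n. (of_nat a :: rat) ^ 3) = of_nat n ^ 4 / 4 - of_nat n ^ 3 / 2 + of_nat n ^ 2 / 4"
  "(\<Sum>a<n. (of_nat a :: rat) ^ 4)
     = of_nat n ^ 5 / 5 - of_nat n ^ 4 / 2 + of_nat n ^ 3 / 3 - of_nat n / 30"
  "(\<Sum>a<n. (of_nat a :: rat) ^ 5)
     = of_nat n ^ 6 / 6 - of_nat n ^ 5 / 2 + 5 * of_nat n ^ 4 / 12 - of_nat n ^ 2 / 12"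
  "(\<Sum>a<n. (of_nat a :: rat) ^ 6)
     = of_nat n ^ 7 / 7 - of_nat n ^ 6 / 2 + of_nat n ^ 5 / 2 - of_nat n ^ 3 / 6 + of_nat n / 42"
  by (induction n) (simp_all add: field_simps eval_nat_numeral)

text \<open>With c = -(a + b), the forms a^2 + a b + b^2 and a b (a + b) are -(ab + bc + ca) and
  -abc. The triples belonging to (a, b - a) and (a - b, b) agree up to order and a common sign, so
  powers of the first form and the square of the second are invariant. Here b = d - a, as the terms
  with x = y require.\<close>

lemma sum_invariant_forms:
  assumes "d > 0"
  shows
    "(\<Sum>a\<in>{0<..<d}. (of_nat a)\<^sup>2 + of_nat a * (of_nat d - of_nat a) + (of_nat d - of_nat a)\<^sup>2)
       = 5 / 6 * of_nat d ^ 3 - of_nat d ^ 2 + (of_nat d :: rat) / 6"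
    "(\<Sum>a\<in>{0<..<d}. ((of_nat a)\<^sup>2 + of_nat a * (of_nat d - of_nat a) + (of_nat d - of_nat a)\<^sup>2) ^ 2)
       = 7 / 10 * of_nat d ^ 5 - of_nat d ^ 4 + of_nat d ^ 3 / 3 - (of_nat d :: rat) / 30"
    "(\<Sum>a\<in>{0<..<d}. ((of_nat a)\<^sup>2 + of_nat a * (of_nat d - of_nat a) + (of_nat d - of_nat a)\<^sup>2) ^ 3)
       = 83 / 140 * of_nat d ^ 7 - of_nat d ^ 6 + of_nat d ^ 5 / 2 - 7 / 60 * of_nat d ^ 3
         + (of_nat d :: rat) / 42"
    "(\<Sum>a\<in>{0<..<d}. (of_nat a * (of_nat d - of_nat a) * of_nat d) ^ 2)
       = (of_nat d ^ 7 - (of_nat d :: rat) ^ 3) / 30"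
proof -
  have set: "{..<d} = insert 0 {0<..<d}"
    using assms by auto
  \<comment> \<open>The formulas for power sums include a = 0, whose term has to be taken
    off.\<close>
  have *: "(\<Sum>a\<in>{0<..<d}. F a) = (\<Sum>a<d. F a) - F 0" for F :: "nat \<Rightarrow> rat"
    by (simp add: set)
  have q: "x\<^sup>2 + x * (y - x) + (y - x)\<^sup>2 = x^2 - y * x + y^2"
    "(x\<^sup>2 + x * (y - x) + (y - x)\<^sup>2)^2 = x^4 - 2*y*x^3 + 3*y^2*x^2 - 2*y^3*x + y^4"
    "(x\<^sup>2 + x * (y - x) + (y - x)\<^sup>2)^3
       = x^6 - 3*y*x^5 + 6*y^2*x^4 - 7*y^3*x^3 + 6*y^4*x^2 - 3*y^5*x + y^6"
    "(x * (y - x) * y)^2 = y^2*x^4 - 2*y^3*x^3 + y^4*x^2" for x y :: rat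
    by algebra+
  show "(\<Sum>a\<in>{0<..<d}. (of_nat a)\<^sup>2 + of_nat a * (of_nat d - of_nat a) + (of_nat d - of_nat a)\<^sup>2)
       = 5 / 6 * of_nat d ^ 3 - of_nat d ^ 2 + (of_nat d :: rat) / 6"
    unfolding * unfolding q(1) unfolding sum.distrib sum_subtractf sum_distrib_left[symmetric] sum_powers sum_constant
    by (simp add: field_simps eval_nat_numeral)
  show "(\<Sum>a\<in>{0<..<d}. ((of_nat a)\<^sup>2 + of_nat a * (of_nat d - of_nat a) + (of_nat d - of_nat a)\<^sup>2) ^ 2)
       = 7 / 10 * of_nat d ^ 5 - of_nat d ^ 4 + of_nat d ^ 3 / 3 - (of_nat d :: rat) / 30"
    unfolding * unfolding q(2) unfolding sum.distrib sum_subtractf sum_distrib_left[symmetric] sum_powers sum_constant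
    by (simp add: field_simps eval_nat_numeral)
  show "(\<Sum>a\<in>{0<..<d}. ((of_nat a)\<^sup>2 + of_nat a * (of_nat d - of_nat a) + (of_nat d - of_nat a)\<^sup>2) ^ 3)
       = 83 / 140 * of_nat d ^ 7 - of_nat d ^ 6 + of_nat d ^ 5 / 2 - 7 / 60 * of_nat d ^ 3
         + (of_nat d :: rat) / 42"
    unfolding * unfolding q(3) unfolding sum.distrib sum_subtractf sum_distrib_left[symmetric] sum_powers sum_constant
    by (simp add: field_simps eval_nat_numeral)
  show "(\<Sum>a\<in>{0<..<d}. (of_nat a * (of_nat d - of_nat a) * of_nat d) ^ 2)
       = (of_nat d ^ 7 - (of_nat d :: rat) ^ 3) / 30"
    unfolding * unfolding q(4) unfolding sum.distrib sum_subtractf sum_distrib_left[symmetric] sum_powers sum_constant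
    by (simp add: field_simps eval_nat_numeral)
qed

section \<open>The convolution identities\<close>

lemma sum_divisors_power:
  "(\<Sum>d | d dvd n. (c * of_nat d ^ r :: rat)) = c * of_nat (divisor_power_sum r n)"
  by (simp add: divisor_power_sum_def sum_distrib_left)

lemma sum_lattice_reps_mult:
  "(\<Sum>(a, b, x, y) \<in> lattice_reps n. c * of_nat a ^ r * of_nat b ^ s)
     = c * (of_nat (divisor_convolution r s n) :: rat)"
  by (simp add: of_nat_divisor_convolution case_prod_unfold sum_distrib_left mult.assoc)

text \<open>Each \<open>h\<close> used for these identities satisfies h(a, b - a) = h(a, -b), so
  h(a, b) - h(a, b - a) is twice the part of \<open>h\<close> that is odd in b. For the quadratic
  form this is 2 a b.\<close>

lemma divisor_convolution_1_1:
  "12 * (of_nat (divisor_convolution 1 1 n) :: rat)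
     = 5 * of_nat (divisor_power_sum 3 n) + (1 - 6 * of_nat n) * of_nat (divisor_power_sum 1 n)"
proof (cases "n = 0")
  case False
  then have pos: "n > 0"
    by simp
  define h :: "rat \<Rightarrow> rat \<Rightarrow> rat" where "h a b = a\<^sup>2 + a * b + b\<^sup>2" for a b
  have inv: "h a (b - a) = h (a - b) b" for a b
    unfolding h_def by algebra
  have "2 * of_nat (divisor_convolution 1 1 n)
      = (\<Sum>(a, b, x, y) \<in> lattice_reps n. h (of_nat a) (of_nat b) - h (of_nat a) (of_nat b - of_nat a))"
    unfolding sum_lattice_reps_mult[symmetric]
    by (intro sum.cong) (auto simp: h_def power2_eq_square algebra_simps)
  also have "\<dots> = (\<Sum>d | d dvd n. (5 / 6 * of_nat d ^ 3 - of_nat d ^ 2 + of_nat d / 6)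
      - of_nat (n div d - 1) * of_nat d ^ 2)"
    unfolding sum_lattice_reps_invariant[of h, OF inv pos] 
    by (intro sum.cong) (simp_all add: h_def sum_invariant_forms[OF dvd_pos_nat[OF pos]] flip: power_mult)
  finally show ?thesis
    using pos sum_divisors_complement[of n 1]
      sum_divisors_power[of "5/6" 3 n] sum_divisors_power[of "1" 2 n]
      sum_divisors_power[of "1/6" 1 n]
    by (simp add: sum.distrib sum_subtractf numeral_2_eq_2 algebra_simps)
qed (simp add: divisor_convolution_def)

lemma divisor_convolution_1_3:
  "240 * (of_nat (divisor_convolution 1 3 n) :: rat)
     = 21 * of_nat (divisor_power_sum 5 n) + (10 - 30 * of_nat n) * of_nat (divisor_power_sum 3 n)
       - of_nat (divisor_power_sum 1 n)"
proof (cases "n = 0")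
  case False
  then have pos: "n > 0"
    by simp
  define h :: "rat \<Rightarrow> rat \<Rightarrow> rat" where "h a b = (a\<^sup>2 + a * b + b\<^sup>2) ^ 2" for a b
  have inv: "h a (b - a) = h (a - b) b" for a b
    unfolding h_def by algebra
  have odd_part: "h a b - h a (b - a) = 4 * a ^ 1 * b ^ 3 + 4 * a ^ 3 * b ^ 1" for a b
    unfolding h_def by algebra
  have "4 * of_nat (divisor_convolution 1 3 n) + 4 * of_nat (divisor_convolution 3 1 n)
      = (\<Sum>(a, b, x, y) \<in> lattice_reps n. h (of_nat a) (of_nat b) - h (of_nat a) (of_nat b - of_nat a))"
    unfolding sum_lattice_reps_mult[symmetric] odd_part by (simp add: case_prod_unfold sum.distrib)
  also have "\<dots> = (\<Sum>d | d dvd n. (7 / 10 * of_nat d ^ 5 - of_nat d ^ 4 + of_nat d ^ 3 / 3 - of_nat d / 30)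
      - of_nat (n div d - 1) * of_nat d ^ 4)"
    unfolding sum_lattice_reps_invariant[of h, OF inv pos] 
    by (intro sum.cong) (simp_all add: h_def sum_invariant_forms[OF dvd_pos_nat[OF pos]] flip: power_mult)
  finally show ?thesis
    using pos sum_divisors_complement[of n 3]
      sum_divisors_power[of "7/10" 5 n] sum_divisors_power[of "1" 4 n]
      sum_divisors_power[of "1/3" 3 n] sum_divisors_power[of "1/30" 1 n]
      divisor_convolution_commute[of 3 1 n]
    by (simp add: sum.distrib sum_subtractf algebra_simps)
qed (simp add: divisor_convolution_def)

lemma divisor_convolution_3_3:
  "120 * (of_nat (divisor_convolution 3 3 n) :: rat)
     = of_nat (divisor_power_sum 7 n) - of_nat (divisor_power_sum 3 n)"
proof (cases "n = 0")
  case False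
  then have pos: "n > 0"
    by simp
  define h :: "rat \<Rightarrow> rat \<Rightarrow> rat" where "h a b = (a * b * (a + b)) ^ 2" for a b
  have inv: "h a (b - a) = h (a - b) b" for a b
    unfolding h_def by algebra
  have odd_part: "h a b - h a (b - a) = 4 * a ^ 3 * b ^ 3" for a b
    unfolding h_def by algebra
  have "4 * of_nat (divisor_convolution 3 3 n)
      = (\<Sum>(a, b, x, y) \<in> lattice_reps n. h (of_nat a) (of_nat b) - h (of_nat a) (of_nat b - of_nat a))"
    unfolding sum_lattice_reps_mult[symmetric] odd_part by (simp add: case_prod_unfold sum.distrib)
  \<comment> \<open>As h(d, 0) = 0, the terms with a = b contribute nothing, and no multiple of n
    arises.\<close>
  also have "\<dots> = (\<Sum>d | d dvd n. (of_nat d ^ 7 - of_nat d ^ 3) / 30 - 0)"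
    unfolding sum_lattice_reps_invariant[of h, OF inv pos] 
    by (intro sum.cong) (simp_all add: h_def sum_invariant_forms[OF dvd_pos_nat[OF pos]] flip: power_mult)
  finally show ?thesis
    using sum_divisors_power[of "1" 7 n] sum_divisors_power[of "1" 3 n]
    by (simp add: sum_subtractf flip: sum_divide_distrib)
qed (simp add: divisor_convolution_def)

text \<open>The cube of the quadratic form also produces 14 a^3 b^3, which
  \<open>divisor_convolution_3_3\<close> removes.\<close>

lemma divisor_convolution_1_5:
  "504 * (of_nat (divisor_convolution 1 5 n) :: rat)
     = 20 * of_nat (divisor_power_sum 7 n) + (21 - 42 * of_nat n) * of_nat (divisor_power_sum 5 n)
       + of_nat (divisor_power_sum 1 n)"
proof (cases "n = 0")
  case False
  then have pos: "n > 0"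
    by simp
  define h :: "rat \<Rightarrow> rat \<Rightarrow> rat" where "h a b = (a\<^sup>2 + a * b + b\<^sup>2) ^ 3" for a b
  have inv: "h a (b - a) = h (a - b) b" for a b
    unfolding h_def by algebra
  have odd_part: "h a b - h a (b - a) = 6 * a ^ 1 * b ^ 5 + 6 * a ^ 5 * b ^ 1 + 14 * a ^ 3 * b ^ 3" for a b
    unfolding h_def by algebra
  have "6 * of_nat (divisor_convolution 1 5 n) + 6 * of_nat (divisor_convolution 5 1 n)
        + 14 * of_nat (divisor_convolution 3 3 n)
      = (\<Sum>(a, b, x, y) \<in> lattice_reps n. h (of_nat a) (of_nat b) - h (of_nat a) (of_nat b - of_nat a))"
    unfolding sum_lattice_reps_mult[symmetric] odd_part by (simp add: case_prod_unfold sum.distrib)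
  also have "\<dots> = (\<Sum>d | d dvd n. (83 / 140 * of_nat d ^ 7 - of_nat d ^ 6 + of_nat d ^ 5 / 2
        - 7 / 60 * of_nat d ^ 3 + of_nat d / 42) - of_nat (n div d - 1) * of_nat d ^ 6)"
    unfolding sum_lattice_reps_invariant[of h, OF inv pos] 
    by (intro sum.cong) (simp_all add: h_def sum_invariant_forms[OF dvd_pos_nat[OF pos]] flip: power_mult)
  finally show ?thesis
    using pos sum_divisors_complement[of n 5]
      sum_divisors_power[of "83/140" 7 n] sum_divisors_power[of "1" 6 n]
      sum_divisors_power[of "1/2" 5 n] sum_divisors_power[of "7/60" 3 n]
      sum_divisors_power[of "1/42" 1 n]
      divisor_convolution_commute[of 5 1 n] divisor_convolution_3_3[of n]
    by (simp add: sum.distrib sum_subtractf algebra_simps)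
qed (simp add: divisor_convolution_def)

section \<open>Ramanujan's identities\<close>

unbundle fps_syntax

section \<open>The derivation q d/dq\<close>

definition q_deriv :: "'a::comm_ring_1 fls \<Rightarrow> 'a fls" where
  "q_deriv f = fls_X * fls_deriv f"

lemma q_deriv_nth: "q_deriv f $$ n = of_int n * f $$ n"
  by (simp add: q_deriv_def fls_X_times_conv_shift)

lemma q_deriv_simps [simp]:
  "q_deriv 0 = 0"
  "q_deriv 1 = 0"
  "q_deriv (fls_const c) = 0"
  "q_deriv (of_nat m) = 0"
  "q_deriv (numeral k) = 0"
  "q_deriv (f + g) = q_deriv f + q_deriv g"
  "q_deriv (f - g) = q_deriv f - q_deriv g"
  "q_deriv (- f) = - q_deriv f"
  "q_deriv (f * g) = q_deriv f * g + f * q_deriv g"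
  by (simp_all add: q_deriv_def algebra_simps)

lemma q_deriv_power [simp]: "q_deriv (f ^ n) = of_nat n * f ^ (n - 1) * q_deriv f"
proof (induction n)
  case (Suc n)
  then show ?case
    by (cases n) (simp_all add: algebra_simps)
qed simp

text \<open>At exponent d m both sides have coefficient d m f_m; all other coefficients
  vanish.\<close>

lemma q_deriv_compose_power:
  "q_deriv (fls_compose_power f d) = of_nat d * fls_compose_power (q_deriv f) d"
proof (cases "d = 0")
  case False
  then show ?thesis
    by (intro fls_eqI)
       (auto simp: q_deriv_nth fls_nth_compose_power fls_of_nat elim!: dvdE simp flip: mult.assoc)
qed simp

section \<open>Generating series of divisor sums\<close>

definition divisor_series :: "nat \<Rightarrow> rat fls" where
  "divisor_series r = fps_to_fls (Abs_fps (\<lambda>n. of_nat (divisor_power_sum r n)))"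

lemma divisor_series_nth:
  "divisor_series r $$ n = (if n < 0 then 0 else of_nat (divisor_power_sum r (nat n)))"
  by (simp add: divisor_series_def)

text \<open>The constant term of \<open>divisor_series r\<close> is 0 by
  \<open>divisor_power_sum_0\<close>, so the case n = 0 becomes the summand 1.\<close>

lemma eisenstein_series_eq: "eisenstein_series c r = 1 + fls_const c * divisor_series r"
  by (intro fls_eqI) (auto simp: eisenstein_series_def divisor_series_nth)

lemma divisor_series_mult_nth:
  "(divisor_series r * divisor_series s) $$ n
     = (if n < 0 then 0 else of_nat (divisor_convolution r s (nat n)))"
proof -
  have "divisor_series r * divisor_series s
      = fps_to_fls (Abs_fps (\<lambda>n. of_nat (divisor_convolution r s n)))"
    unfolding divisor_series_def fls_times_fps_to_fls[symmetric]
    by (intro arg_cong[of _ _ fps_to_fls] fps_ext)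
       (simp add: fps_mult_nth divisor_convolution_def atMost_atLeast0)
  then show ?thesis
    by simp
qed

text \<open>These are the convolution identities read coefficientwise; multiplication of a
  coefficient by n is \<open>q_deriv\<close>.\<close>

lemma divisor_series_identities:
  "12 * divisor_series 1 ^ 2
     = 5 * divisor_series 3 + divisor_series 1 - 6 * q_deriv (divisor_series 1)"
  "240 * (divisor_series 1 * divisor_series 3)
     = 21 * divisor_series 5 + 10 * divisor_series 3 - 30 * q_deriv (divisor_series 3) - divisor_series 1"
  "120 * divisor_series 3 ^ 2 = divisor_series 7 - divisor_series 3"
  "504 * (divisor_series 1 * divisor_series 5)
     = 20 * divisor_series 7 + 21 * divisor_series 5 - 42 * q_deriv (divisor_series 5) + divisor_series 1"
proof -
  note nth = power2_eq_square q_deriv_nth divisor_series_nth divisor_series_mult_nth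
  show "12 * divisor_series 1 ^ 2
      = 5 * divisor_series 3 + divisor_series 1 - 6 * q_deriv (divisor_series 1)"
  proof (rule fls_eqI)
    fix n
    show "(12 * divisor_series 1 ^ 2) $$ n
        = (5 * divisor_series 3 + divisor_series 1 - 6 * q_deriv (divisor_series 1)) $$ n"
      using divisor_convolution_1_1[of "nat n"] by (simp add: nth ring_distribs)
  qed
  show "240 * (divisor_series 1 * divisor_series 3)
      = 21 * divisor_series 5 + 10 * divisor_series 3 - 30 * q_deriv (divisor_series 3) - divisor_series 1"
  proof (rule fls_eqI)
    fix n
    show "(240 * (divisor_series 1 * divisor_series 3)) $$ n
        = (21 * divisor_series 5 + 10 * divisor_series 3 - 30 * q_deriv (divisor_series 3)
           - divisor_series 1) $$ n"
      using divisor_convolution_1_3[of "nat n"] by (simp add: nth ring_distribs)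
  qed
  show "120 * divisor_series 3 ^ 2 = divisor_series 7 - divisor_series 3"
  proof (rule fls_eqI)
    fix n
    show "(120 * divisor_series 3 ^ 2) $$ n = (divisor_series 7 - divisor_series 3) $$ n"
      using divisor_convolution_3_3[of "nat n"] by (simp add: nth)
  qed
  show "504 * (divisor_series 1 * divisor_series 5)
      = 20 * divisor_series 7 + 21 * divisor_series 5 - 42 * q_deriv (divisor_series 5) + divisor_series 1"
  proof (rule fls_eqI)
    fix n
    show "(504 * (divisor_series 1 * divisor_series 5)) $$ n
        = (20 * divisor_series 7 + 21 * divisor_series 5 - 42 * q_deriv (divisor_series 5)
           + divisor_series 1) $$ n"
      using divisor_convolution_1_5[of "nat n"] by (simp add: nth ring_distribs)
  qed
qed

unbundle no fps_syntax

section \<open>From divisor series to Eisenstein series\<close>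

lemma E2_eq: "E2 = 1 - 24 * divisor_series 1"
  and E4_eq: "E4 = 1 + 240 * divisor_series 3"
  and E6_eq: "E6 = 1 - 504 * divisor_series 5"
  by (simp_all add: E2_def E4_def E6_def eisenstein_series_eq)

lemma q_deriv_eisenstein:
  "q_deriv E2 = - 24 * q_deriv (divisor_series 1)"
  "q_deriv E4 = 240 * q_deriv (divisor_series 3)"
  "q_deriv E6 = - 504 * q_deriv (divisor_series 5)"
  unfolding E2_eq E4_eq E6_eq by simp_all

lemma ramanujan_E2: "12 * q_deriv E2 = E2 ^ 2 - E4"
  using divisor_series_identities(1) q_deriv_eisenstein(1) E2_eq E4_eq by algebra

lemma ramanujan_E4: "3 * q_deriv E4 = E2 * E4 - E6"
  using divisor_series_identities(2) q_deriv_eisenstein(2) E2_eq E4_eq E6_eq by algebra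

text \<open>The third identity says that E4^2 = 1 + 480 \<open>divisor_series 7\<close>; it serves
  to eliminate \<open>divisor_series 7\<close> from the fourth.\<close>

lemma ramanujan_E6: "2 * q_deriv E6 = E2 * E6 - E4 ^ 2"
  using divisor_series_identities(3,4) q_deriv_eisenstein(3) E2_eq E4_eq E6_eq by algebra

section \<open>Trivariate polynomials evaluated at series\<close>

lemma eval1_pCons [simp]: "eval1 (pCons a p) z = fls_const a + z * eval1 p z"
  by (simp add: eval1_def map_poly_pCons)

lemma eval1_0 [simp]: "eval1 0 z = 0"
  by (simp add: eval1_def)

lemma eval2_pCons [simp]: "eval2 (pCons a p) y z = eval1 a z + y * eval2 p y z"
  by (simp add: eval2_def map_poly_pCons)

lemma eval2_0 [simp]: "eval2 0 y z = 0"
  by (simp add: eval2_def)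

lemma eval3_pCons [simp]: "eval3 (pCons a p) x y z = eval2 a y z + x * eval3 p x y z"
  by (simp add: eval3_def specialize_YZ_def map_poly_pCons)

lemma eval3_0 [simp]: "eval3 0 x y z = 0"
  by (simp add: eval3_def specialize_YZ_def)

lemma eval1_add [simp]: "eval1 (p + q) z = eval1 p z + eval1 q z"
  by (induction p q rule: poly_induct2) (simp_all add: algebra_simps flip: fls_plus_const)

lemma eval2_add [simp]: "eval2 (p + q) y z = eval2 p y z + eval2 q y z"
  by (induction p q rule: poly_induct2) (simp_all add: algebra_simps)

lemma eval3_add [simp]: "eval3 (p + q) x y z = eval3 p x y z + eval3 q x y z"
  by (induction p q rule: poly_induct2) (simp_all add: algebra_simps)

lemma eval1_smult [simp]: "eval1 (smult c p) z = fls_const c * eval1 p z"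
  by (induction p) (simp_all add: algebra_simps flip: fls_const_mult_const)

lemma eval1_mult [simp]: "eval1 (p * q) z = eval1 p z * eval1 q z"
  by (induction p) (simp_all add: algebra_simps)

lemma eval2_smult [simp]: "eval2 (smult c p) y z = eval1 c z * eval2 p y z"
  by (induction p) (simp_all add: algebra_simps)

lemma eval2_of_nat_mult: "eval2 (of_nat m * p) y z = of_nat m * eval2 p y z"
  by (induction m) (simp_all add: algebra_simps)

lemma eval3_of_nat_mult: "eval3 (of_nat m * p) x y z = of_nat m * eval3 p x y z"
  by (induction m) (simp_all add: algebra_simps)

text \<open>Applying \<open>pCons 0\<close> at a given level of nesting multiplies by the variable
  of that level. In this form Euler's relation can be stated between polynomials.\<close>

lemma eval2_map_pCons_0 [simp]: "eval2 (map_poly (pCons 0) p) y z = z * eval2 p y z"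
  by (induction p) (simp_all add: map_poly_pCons algebra_simps)

lemma eval3_map_pCons_0 [simp]: "eval3 (map_poly (pCons 0) p) x y z = y * eval3 p x y z"
  by (induction p) (simp_all add: map_poly_pCons algebra_simps)

lemma eval3_map_map_pCons_0 [simp]:
  "eval3 (map_poly (map_poly (pCons 0)) p) x y z = z * eval3 p x y z"
  by (induction p) (simp_all add: map_poly_pCons algebra_simps)

section \<open>Chain rule and partial derivatives\<close>

lemma q_deriv_eval1: "q_deriv (eval1 p z) = eval1 (pderiv p) z * q_deriv z"
  by (induction p) (simp_all add: pderiv_pCons algebra_simps)

lemma q_deriv_eval2:
  "q_deriv (eval2 p y z) = eval2 (pderiv p) y z * q_deriv y + eval2 (map_poly pderiv p) y z * q_deriv z"
  by (induction p) (simp_all add: pderiv_pCons map_poly_pCons q_deriv_eval1 algebra_simps)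

lemma q_deriv_eval3:
  "q_deriv (eval3 P x y z) = eval3 (pderiv_X P) x y z * q_deriv x
     + eval3 (pderiv_Y P) x y z * q_deriv y + eval3 (pderiv_Z P) x y z * q_deriv z"
  unfolding pderiv_X_def pderiv_Y_def pderiv_Z_def
  by (induction P) (simp_all add: pderiv_pCons map_poly_pCons q_deriv_eval2 algebra_simps)

lemma coeff_of_nat_mult: "coeff (of_nat m * p) i = of_nat m * coeff p i"
  by (simp add: of_nat_poly)

lemma coeff_pderiv_X:
  "coeff (coeff (coeff (pderiv_X P) i) j) k = of_nat (Suc i) * coeff (coeff (coeff P (Suc i)) j) k"
  unfolding pderiv_X_def coeff_pderiv coeff_of_nat_mult ..

lemma coeff_pderiv_Y:
  "coeff (coeff (coeff (pderiv_Y P) i) j) k = of_nat (Suc j) * coeff (coeff (coeff P i) (Suc j)) k"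
  by (simp add: pderiv_Y_def coeff_map_poly coeff_pderiv coeff_of_nat_mult del: of_nat_Suc)

lemma coeff_pderiv_Z:
  "coeff (coeff (coeff (pderiv_Z P) i) j) k = of_nat (Suc k) * coeff (coeff (coeff P i) j) (Suc k)"
  by (simp add: pderiv_Z_def coeff_map_poly coeff_pderiv coeff_of_nat_mult del: of_nat_Suc)

lemma pderiv_commute:
  "pderiv_Y (pderiv_X P) = pderiv_X (pderiv_Y P)"
  "pderiv_Z (pderiv_X P) = pderiv_X (pderiv_Z P)"
  "pderiv_Z (pderiv_Y P) = pderiv_Y (pderiv_Z P)"
  by (intro poly_eqI; simp only: coeff_pderiv_X coeff_pderiv_Y coeff_pderiv_Z mult_ac)+

text \<open>Truncated subtraction does no harm: a nonzero coefficient of a derivative comes from a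
  monomial of weight n containing the variable, so n is at least the weight of that
  variable.\<close>

lemma weighted_homogeneous_pderiv:
  assumes "weighted_homogeneous a b c n P"
  shows "weighted_homogeneous a b c (n - a) (pderiv_X P)"
    and "weighted_homogeneous a b c (n - b) (pderiv_Y P)"
    and "weighted_homogeneous a b c (n - c) (pderiv_Z P)"
  using assms
  by (fastforce simp: weighted_homogeneous_def coeff_pderiv_X coeff_pderiv_Y coeff_pderiv_Z
      simp del: of_nat_Suc)+

text \<open>The Euler operator multiplies the monomial X^i Y^j Z^k by a i + b j + c k, which is n
  wherever the coefficient is nonzero. Comparing coefficients gives a polynomial identity, which is
  then evaluated.\<close>

lemma euler_weighted_homogeneous:
  assumes "weighted_homogeneous a b c n P"
  shows "of_nat a * x * eval3 (pderiv_X P) x y z + of_nat b * y * eval3 (pderiv_Y P) x y z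
      + of_nat c * z * eval3 (pderiv_Z P) x y z = of_nat n * eval3 P x y z"
proof -
  have "of_nat a * pCons 0 (pderiv_X P) + of_nat b * map_poly (pCons 0) (pderiv_Y P)
      + of_nat c * map_poly (map_poly (pCons 0)) (pderiv_Z P) = of_nat n * P" (is "?Q = _")
  proof (intro poly_eqI)
    fix i j k
    have X: "coeff (coeff (coeff (pCons 0 (pderiv_X P)) i) j) k = of_nat i * coeff (coeff (coeff P i) j) k"
      by (cases i) (simp_all add: coeff_pderiv_X)
    have Y: "coeff (coeff (coeff (map_poly (pCons 0) (pderiv_Y P)) i) j) k
        = of_nat j * coeff (coeff (coeff P i) j) k"
      by (cases j) (simp_all add: coeff_map_poly coeff_pderiv_Y)
    have Z: "coeff (coeff (coeff (map_poly (map_poly (pCons 0)) (pderiv_Z P)) i) j) k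
        = of_nat k * coeff (coeff (coeff P i) j) k"
      by (cases k) (simp_all add: coeff_map_poly coeff_pderiv_Z)
    have "coeff (coeff (coeff ?Q i) j) k = of_nat a * (of_nat i * coeff (coeff (coeff P i) j) k)
        + of_nat b * (of_nat j * coeff (coeff (coeff P i) j) k)
        + of_nat c * (of_nat k * coeff (coeff (coeff P i) j) k)"
      unfolding coeff_add coeff_of_nat_mult X Y Z ..
    also have "\<dots> = of_nat (a * i + b * j + c * k) * coeff (coeff (coeff P i) j) k"
      by (simp add: algebra_simps)
    also have "\<dots> = of_nat n * coeff (coeff (coeff P i) j) k"
      using assms unfolding weighted_homogeneous_def by (cases "coeff (coeff (coeff P i) j) k = 0") auto
    finally show "coeff (coeff (coeff ?Q i) j) k = coeff (coeff (coeff (of_nat n * P) i) j) k"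
      by (simp add: coeff_of_nat_mult)
  qed
  then have "eval3 ?Q x y z = eval3 (of_nat n * P) x y z"
    by simp
  then show ?thesis
    by (simp add: eval3_of_nat_mult mult.assoc mult.left_commute[of x])
qed

section \<open>Rescaling of the variables\<close>

lemma eval1_pcompose_monomial: "eval1 (pcompose p [:0, c:]) z = eval1 p (fls_const c * z)"
  by (induction p) (simp_all add: pcompose_pCons algebra_simps)

lemma eval2_pcompose_monomial: "eval2 (pcompose p [:0, c:]) y z = eval2 p (eval1 c z * y) z"
  by (induction p) (simp_all add: pcompose_pCons algebra_simps)

lemma eval2_map_pcompose_monomial:
  "eval2 (map_poly (\<lambda>r. pcompose r [:0, c:]) p) y z = eval2 p y (fls_const c * z)"
  by (induction p) (simp_all add: map_poly_pCons eval1_pcompose_monomial)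

text \<open>At (E4, E6) the right-hand side is the minimal polynomial of \<sigma>, to which
  separability applies.\<close>

lemma specialize_YZ_rescale_ccr: "specialize_YZ (rescale_ccr P) y z = specialize_YZ P (- 3 * y) (- 2 * z)"
proof -
  \<comment> \<open>The scale factor of Y is a polynomial in Z, that of Z a rational number; both
    must be recognised as numerals among the series.\<close>
  have "eval1 (- 3) z = - 3"
    using eval1_pCons[of "- 3" 0 z] by (simp add: numeral_poly)
  moreover have "fls_const (- 2) = (- 2 :: rat fls)"
    by simp
  ultimately show ?thesis
    unfolding specialize_YZ_def rescale_ccr_def
    by (subst map_poly_map_poly)
       (simp_all add: o_def eval2_pcompose_monomial eval2_map_pcompose_monomial)
qed

lemma specialize_YZ_pderiv_X: "specialize_YZ (pderiv_X P) y z = pderiv (specialize_YZ P y z)"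
  by (intro poly_eqI)
     (simp add: specialize_YZ_def pderiv_X_def coeff_map_poly coeff_pderiv eval2_of_nat_mult del: of_nat_Suc)

section \<open>Separability of minimal polynomials\<close>

lemma is_subfield_generated_subfield: "is_subfield (generated_subfield S)"
  unfolding generated_subfield_def is_subfield_def by auto

lemma is_subfield_of_nat_mult:
  assumes "is_subfield K" "x \<in> K"
  shows "of_nat m * x \<in> K"
proof -
  have "of_nat m \<in> K"
  proof (induction m)
    case (Suc m)
    \<comment> \<open>\<open>is_subfield\<close> speaks of differences only, so m + 1 is reached as
      m - (0 - 1).\<close>
    have "of_nat m - (0 - 1) \<in> K"
      using assms(1) Suc unfolding is_subfield_def by blast
    then show ?case
      by (simp add: add.commute)
  qed (use assms(1) in \<open>simp add: is_subfield_def\<close>)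
  then show ?thesis
    using assms unfolding is_subfield_def by blast
qed

text \<open>In characteristic 0 the derivative of a nonconstant polynomial is nonzero and of smaller
  degree. It has coefficients in \<open>K\<close>, so a zero at \<open>x\<close> would contradict
  minimality. This makes the denominator \<open>ds\<close> nonzero.\<close>

lemma minimal_polynomial_separable:
  fixes x :: "'a::field_char_0"
  assumes "is_subfield K" "is_minimal_polynomial K x p"
  shows "poly (pderiv p) x \<noteq> 0"
proof
  assume root: "poly (pderiv p) x = 0"
  have deg: "degree p \<noteq> 0"
  proof
    assume "degree p = 0"
    then obtain c where "p = [:c:]"
      by (rule degree_eq_zeroE)
    then show False
      using assms(2) by (auto simp: is_minimal_polynomial_def)
  qed
  have "coeff (pderiv p) i \<in> K" for i
    unfolding coeff_pderiv using assms
    by (intro is_subfield_of_nat_mult) (simp_all add: is_minimal_polynomial_def)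
  moreover have "pderiv p \<noteq> 0"
    using deg by (simp add: pderiv_eq_0_iff)
  ultimately have "degree p \<le> degree (pderiv p)"
    using root assms(2) by (auto simp: is_minimal_polynomial_def)
  then show False
    using deg by (simp add: degree_pderiv)
qed

section \<open>The second derivative of the CCR relation\<close>

text \<open>
  The series \<open>D f - w E2 f / 6\<close> is free of \<open>E2\<close> for a polynomial \<open>f\<close> of weight \<open>w\<close> in \<open>\<sigma>\<close>, \<open>E4\<close>, \<open>E6\<close>; it is
  \<open>T\<close> for \<open>f = \<sigma>\<close>. The first derivative gives
  \<open>24 L T = 4 \<sigma>\<^sup>2 - L\<^sup>4 E4(q\<^sup>L) + L\<^sup>2 E4\<close>, which is then differentiated again.
\<close>
lemma ccr_second_derivative_identity:
  fixes L s P Q R Pt Qt Rt :: "'a::field_char_0"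
  assumes nz: "L \<noteq> 0" "ds \<noteq> 0"
    and euler: "s * ds + 2 * Q * d4 + 3 * R * d6 = 0"
      "s * dss + 2 * Q * ds4 + 3 * R * ds6 = L * ds"
      "s * ds4 + 2 * Q * d44 + 3 * R * d46 = (L - 1) * d4"
      "s * ds6 + 2 * Q * d46 + 3 * R * d66 = (L - 2) * d6"
    and sigma: "2 * s = L * (L * Pt - P)" "2 * s' = L * (L * Pt' - P')"
    and ramanujan: "12 * P' = P ^ 2 - Q" "3 * Q' = P * Q - R" "2 * R' = P * R - Q ^ 2"
      "12 * Pt' = L * (Pt ^ 2 - Qt)" "3 * Qt' = L * (Pt * Qt - Rt)"
    and chain: "ds * s' + d4 * Q' + d6 * R' = 0"
      "ds' = dss * s' + ds4 * Q' + ds6 * R'"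
      "d4' = ds4 * s' + d44 * Q' + d46 * R'"
      "d6' = ds6 * s' + d46 * Q' + d66 * R'"
    and T: "6 * ds * T = 2 * R * d4 + 3 * Q ^ 2 * d6"
    and T': "6 * (ds' * T + ds * T') = 2 * (R' * d4 + R * d4') + 3 * (2 * Q * Q' * d6 + Q ^ 2 * d6')"
    and Qt': "4 * s ^ 2 - L ^ 4 * Qt + L ^ 2 * Q = 24 * L * T \<Longrightarrow>
      8 * s * s' - L ^ 4 * Qt' + L ^ 2 * Q' = 24 * L * T'"
  shows "L ^ 6 * ds ^ 3 * Rt = R * ds ^ 3 * L ^ 3
      - (18 * (d6 ^ 2 * dss - 2 * d6 * ds * ds6 + d66 * ds ^ 2) * Q ^ 4
            + (24 * R * d4 * (d6 * dss - ds * ds6)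
               + 24 * R * ds * (d46 * ds - d6 * ds4)
               + 10 * d4 * ds ^ 2) * Q ^ 2
            + 3 * ds ^ 2 * (7 * R * d6 - s * ds) * Q
            + 8 * R ^ 2 * (d4 ^ 2 * dss - 2 * d4 * ds * ds4 + d44 * ds ^ 2)) * L ^ 2
      - 12 * ds ^ 2 * s * (3 * Q ^ 2 * d6 + 2 * R * d4) * L + 8 * ds ^ 3 * s ^ 3"
proof -
  \<comment> \<open>By Euler's relation the terms with \<open>P\<close> in the differentiated
    relation add up to \<open>s * ds * P\<close>.\<close>
  have "ds * (6 * s') = ds * (s * P + 6 * T)"
    using euler(1) chain(1) ramanujan(2,3) T by algebra
  then have s': "6 * s' = s * P + 6 * T"
    using nz by simp
  have Pt: "L ^ 2 * Pt = 2 * s + L * P"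
    using sigma(1) by algebra
  have "24 * s' = L * (L ^ 2 * Pt ^ 2 - L ^ 2 * Qt - P ^ 2 + Q)"
    using sigma(2) ramanujan(1,4) by algebra
  then have "24 * L * s' = 4 * s ^ 2 + 4 * s * L * P - L ^ 4 * Qt + L ^ 2 * Q"
    using Pt by algebra
  then have Qt: "4 * s ^ 2 - L ^ 4 * Qt + L ^ 2 * Q = 24 * L * T"
    using s' by algebra
  \<comment> \<open>Euler's relations for the first partials, of weights \<open>L\<close>,
    \<open>L - 1\<close> and \<open>L - 2\<close>, collect the terms with \<open>P\<close> in the
    next three equations.\<close>
  have ds': "6 * ds' = L * P * ds + 6 * T * dss - 2 * R * ds4 - 3 * Q ^ 2 * ds6"
    using chain(2) s' ramanujan(2,3) euler(2) by algebra
  have d4': "6 * d4' = (L - 1) * P * d4 + 6 * T * ds4 - 2 * R * d44 - 3 * Q ^ 2 * d46"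
    using chain(3) s' ramanujan(2,3) euler(3) by algebra
  have d6': "6 * d6' = (L - 2) * P * d6 + 6 * T * ds6 - 2 * R * d46 - 3 * Q ^ 2 * d66"
    using chain(4) s' ramanujan(2,3) euler(4) by algebra
  \<comment> \<open>\<open>W\<close> is the part of \<open>36 * ds * T'\<close> without an explicit
    \<open>P\<close>. The remaining part is \<open>12 * P * ds * T\<close>, in accordance with
    weight 2 for \<open>T\<close>.\<close>
  define W where "W = 2 * R * (6 * T * ds4 - 2 * R * d44 - 3 * Q ^ 2 * d46)
      + 3 * Q ^ 2 * (6 * T * ds6 - 2 * R * d46 - 3 * Q ^ 2 * d66)
      - 6 * T * (6 * T * dss - 2 * R * ds4 - 3 * Q ^ 2 * ds6) - 6 * d4 * Q ^ 2 - 12 * d6 * Q * R"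
  have W: "36 * ds * T' - 12 * P * ds * T = W"
  proof -
    have "36 * ds * T' = 2 * R * (6 * d4') + 6 * d4 * (2 * R') + 3 * Q ^ 2 * (6 * d6')
        + 12 * d6 * Q * (3 * Q') - 6 * T * (6 * ds')"
      using T' by algebra
    also have "\<dots> = (L + 2) * P * (2 * R * d4 + 3 * Q ^ 2 * d6) - L * P * (6 * ds * T) + W"
      unfolding ds' d4' d6' ramanujan W_def by algebra
    finally show ?thesis
      unfolding T[symmetric] by algebra
  qed
  \<comment> \<open>\<open>W\<close> is quadratic in \<open>T\<close>, which has denominator
    \<open>6 * ds\<close>. After multiplication by \<open>ds ^ 2\<close> only
    \<open>M = 6 * ds * T\<close> occurs, a polynomial in the partials, \<open>Q\<close> and
    \<open>R\<close>.\<close>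
  have W2: "ds ^ 2 * W = 2 * R * (M * ds * ds4 - 2 * R * d44 * ds ^ 2 - 3 * Q ^ 2 * d46 * ds ^ 2)
      + 3 * Q ^ 2 * (M * ds * ds6 - 2 * R * d46 * ds ^ 2 - 3 * Q ^ 2 * d66 * ds ^ 2)
      - M * (M * dss - 2 * R * ds4 * ds - 3 * Q ^ 2 * ds6 * ds)
      - 6 * d4 * Q ^ 2 * ds ^ 2 - 12 * d6 * Q * R * ds ^ 2"
    if "M = 6 * ds * T" for M
    unfolding W_def that by algebra
  have "72 * L * T' = 4 * s * (6 * s') - L ^ 4 * (3 * Qt') + L ^ 2 * (3 * Q')"
    using Qt'[OF Qt] by algebra
  also have "\<dots> = 4 * s * (s * P + 6 * T) - L ^ 3 * (L ^ 2 * Pt) * Qt + L ^ 5 * Rt + L ^ 2 * (P * Q - R)"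
    unfolding s' ramanujan by algebra
  finally have "L ^ 5 * Rt = 72 * L * T' - 4 * s * (s * P + 6 * T) + L ^ 3 * (2 * s + L * P) * Qt
      - L ^ 2 * (P * Q - R)"
    unfolding Pt by algebra
  then have "L ^ 6 * Rt = 72 * L ^ 2 * T' - 4 * L * s * (s * P + 6 * T) + (2 * s + L * P) * (L ^ 4 * Qt)
      - L ^ 3 * (P * Q - R)"
    by algebra
  also have "L ^ 4 * Qt = 4 * s ^ 2 + L ^ 2 * Q - 24 * L * T"
    using Qt by algebra
  \<comment> \<open>All terms with \<open>P\<close> cancel except
    \<open>- 24 * L ^ 2 * P * T\<close>, which completes \<open>72 * T'\<close> to the combination
    that \<open>W\<close> evaluates.\<close>
  finally have Rt: "L ^ 6 * Rt = L ^ 3 * R + L ^ 2 * (72 * T' - 24 * P * T + 2 * s * Q) - 72 * L * s * T + 8 * s ^ 3"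
    by algebra
  have "L ^ 6 * ds ^ 3 * Rt = ds ^ 3 * (L ^ 6 * Rt)"
    by algebra
  also have "\<dots> = L ^ 3 * R * ds ^ 3 + 2 * L ^ 2 * (ds ^ 2 * (36 * ds * T' - 12 * P * ds * T))
      + 2 * L ^ 2 * s * Q * ds ^ 3 - 12 * L * s * ds ^ 2 * (6 * ds * T) + 8 * s ^ 3 * ds ^ 3"
    unfolding Rt by algebra
  \<comment> \<open>Euler's relation replaces the product \<open>s * ds\<close> accompanying
    \<open>Q\<close> here, and \<open>eu\<close> does the same in the goal. What then remains is a
    polynomial identity.\<close>
  also have "\<dots> = L ^ 3 * R * ds ^ 3 + 2 * L ^ 2 * (ds ^ 2 * W)
      - L ^ 2 * Q * ds ^ 2 * (2 * (2 * Q * d4 + 3 * R * d6)) - 12 * L * s * ds ^ 2 * (6 * ds * T) + 8 * s ^ 3 * ds ^ 3"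
    unfolding W using euler(1) by algebra
  finally have fin: "L ^ 6 * ds ^ 3 * Rt = L ^ 3 * R * ds ^ 3 + 2 * L ^ 2 * (ds ^ 2 * W)
      - L ^ 2 * Q * ds ^ 2 * (2 * (2 * Q * d4 + 3 * R * d6)) - 12 * L * s * ds ^ 2 * (6 * ds * T) + 8 * s ^ 3 * ds ^ 3" .
  have eu: "3 * ds ^ 2 * (7 * R * d6 - s * ds) * Q = 3 * ds ^ 2 * (10 * R * d6 + 2 * Q * d4) * Q"
    using euler(1) by algebra
  show ?thesis
    unfolding fin W2[OF T[symmetric]] T eu by algebra
qed

text \<open>Substituting q^l respects sums and products, while \<open>q_deriv\<close> brings out a
  factor l.\<close>

lemma ramanujan_compose_power:
  assumes "l > 0"
  defines "P \<equiv> fls_compose_power E2 l" and "Q \<equiv> fls_compose_power E4 l" and "R \<equiv> fls_compose_power E6 l"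
  shows "12 * q_deriv P = of_nat l * (P ^ 2 - Q)" and "3 * q_deriv Q = of_nat l * (P * Q - R)"
proof -
  have num: "fls_compose_power (numeral k * f) l = numeral k * fls_compose_power f l" for k and f :: "rat fls"
    using assms(1) fls_compose_power_const_left[of l "numeral k :: rat"] by simp
  have "12 * q_deriv P = of_nat l * fls_compose_power (12 * q_deriv E2) l"
    unfolding P_def q_deriv_compose_power num by simp
  then show "12 * q_deriv P = of_nat l * (P ^ 2 - Q)"
    using assms(1) unfolding ramanujan_E2 by (simp add: P_def Q_def)
  have "3 * q_deriv Q = of_nat l * fls_compose_power (3 * q_deriv E4) l"
    unfolding Q_def q_deriv_compose_power num by simp
  then show "3 * q_deriv Q = of_nat l * (P * Q - R)"
    unfolding ramanujan_E4 by (simp add: P_def Q_def R_def)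
qed

theorem proposition4p2:
  fixes l :: nat and U_l :: poly3
  assumes "prime l" and "odd l" and "is_ccr_polynomial l U_l"
  shows
    "let U = rescale_ccr U_l;
         \<sigma> = sigma_series l;
         L = (of_nat l :: rat fls);
         ev = (\<lambda>P. eval3 P \<sigma> E4 E6);
         ds = ev (pderiv_X U);
         d4 = ev (pderiv_Y U);
         d6 = ev (pderiv_Z U);
         dss = ev (pderiv_X (pderiv_X U));
         ds4 = ev (pderiv_X (pderiv_Y U));
         ds6 = ev (pderiv_X (pderiv_Z U));
         d44 = ev (pderiv_Y (pderiv_Y U));
         d46 = ev (pderiv_Y (pderiv_Z U));
         d66 = ev (pderiv_Z (pderiv_Z U));
         c2 = 18 * (d6 ^ 2 * dss - 2 * d6 * ds * ds6 + d66 * ds ^ 2) * E4 ^ 4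
            + (24 * E6 * d4 * (d6 * dss - ds * ds6)
               + 24 * E6 * ds * (d46 * ds - d6 * ds4)
               + 10 * d4 * ds ^ 2) * E4 ^ 2
            + 3 * ds ^ 2 * (7 * E6 * d6 - \<sigma> * ds) * E4
            + 8 * E6 ^ 2 * (d4 ^ 2 * dss - 2 * d4 * ds * ds4 + d44 * ds ^ 2);
         N = - E6 * ds ^ 3 * L ^ 3 + c2 * L ^ 2
            + 12 * ds ^ 2 * \<sigma> * (3 * E4 ^ 2 * d6 + 2 * E6 * d4) * L
            - 8 * ds ^ 3 * \<sigma> ^ 3
     in fls_compose_power E6 l = - (N / (L ^ 6 * ds ^ 3))"
proof -
  \<comment> \<open>This turns the truncated degrees l + 1 - 2 and l + 1 - 3 of the partial
    derivatives into \<open>L - 1\<close> and \<open>L - 2\<close>.\<close>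
  have l3: "l \<ge> 3"
    using assms(1,2) prime_ge_2_nat[of l] by (cases "l = 2") auto
  define U where "U = rescale_ccr U_l"
  define \<sigma> where "\<sigma> = sigma_series l"
  define L where "L = (of_nat l :: rat fls)"
  define ev where "ev = (\<lambda>P. eval3 P \<sigma> E4 E6)"
  define ds where "ds = ev (pderiv_X U)"
  define d4 where "d4 = ev (pderiv_Y U)"
  define d6 where "d6 = ev (pderiv_Z U)"
  define dss where "dss = ev (pderiv_X (pderiv_X U))"
  define ds4 where "ds4 = ev (pderiv_X (pderiv_Y U))"
  define ds6 where "ds6 = ev (pderiv_X (pderiv_Z U))"
  define d44 where "d44 = ev (pderiv_Y (pderiv_Y U))"
  define d46 where "d46 = ev (pderiv_Y (pderiv_Z U))"
  define d66 where "d66 = ev (pderiv_Z (pderiv_Z U))"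
  note d_defs = ds_def d4_def d6_def dss_def ds4_def ds6_def d44_def d46_def d66_def
  define Pt Qt Rt where "Pt = fls_compose_power E2 l"
    and "Qt = fls_compose_power E4 l" and "Rt = fls_compose_power E6 l"
  \<comment> \<open>This is the E2-free part of \<open>q_deriv \<sigma>\<close>, obtained by solving
    the differentiated relation for it.\<close>
  define T where "T = (2 * E6 * d4 + 3 * E4 ^ 2 * d6) / (6 * ds)"

  have spec: "specialize_YZ U E4 E6 = specialize_YZ U_l (- 3 * E4) (- 2 * E6)"
    by (simp add: U_def specialize_YZ_rescale_ccr)
  have root: "ev U = 0"
    using assms(3) by (simp add: ev_def eval3_def spec \<sigma>_def is_ccr_polynomial_def)
  have ds_nz: "ds \<noteq> 0"
    using assms(3) minimal_polynomial_separable[OF is_subfield_generated_subfield]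
    unfolding ds_def ev_def eval3_def specialize_YZ_pderiv_X spec \<sigma>_def is_ccr_polynomial_def by blast
  have L_nz: "L \<noteq> 0"
    using l3 by (simp add: L_def)

  have wh: "weighted_homogeneous 1 2 3 (l + 1) U"
    using assms(3) by (simp add: U_def is_ccr_polynomial_def)
  have ev_euler: "\<sigma> * ev (pderiv_X P) + 2 * E4 * ev (pderiv_Y P) + 3 * E6 * ev (pderiv_Z P) = of_nat n * ev P"
    if "weighted_homogeneous 1 2 3 n P" for n P
    using euler_weighted_homogeneous[OF that, of \<sigma> E4 E6] by (simp add: ev_def)
  have euler: "\<sigma> * ds + 2 * E4 * d4 + 3 * E6 * d6 = 0"
    "\<sigma> * dss + 2 * E4 * ds4 + 3 * E6 * ds6 = L * ds"
    "\<sigma> * ds4 + 2 * E4 * d44 + 3 * E6 * d46 = (L - 1) * d4"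
    "\<sigma> * ds6 + 2 * E4 * d46 + 3 * E6 * d66 = (L - 2) * d6"
    using ev_euler[OF wh] ev_euler[OF weighted_homogeneous_pderiv(1)[OF wh]]
      ev_euler[OF weighted_homogeneous_pderiv(2)[OF wh]]
      ev_euler[OF weighted_homogeneous_pderiv(3)[OF wh]] l3
    by (simp_all add: d_defs L_def root pderiv_commute of_nat_diff)

  have ev_chain: "q_deriv (ev P)
      = ev (pderiv_X P) * q_deriv \<sigma> + ev (pderiv_Y P) * q_deriv E4 + ev (pderiv_Z P) * q_deriv E6" for P
    unfolding ev_def by (rule q_deriv_eval3)
  have chain: "ds * q_deriv \<sigma> + d4 * q_deriv E4 + d6 * q_deriv E6 = 0"
    "q_deriv ds = dss * q_deriv \<sigma> + ds4 * q_deriv E4 + ds6 * q_deriv E6"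
    "q_deriv d4 = ds4 * q_deriv \<sigma> + d44 * q_deriv E4 + d46 * q_deriv E6"
    "q_deriv d6 = ds6 * q_deriv \<sigma> + d46 * q_deriv E4 + d66 * q_deriv E6"
    using ev_chain[of U] ev_chain[of "pderiv_X U"] ev_chain[of "pderiv_Y U"] ev_chain[of "pderiv_Z U"]
    by (simp_all add: d_defs root pderiv_commute)

  have sigma: "2 * \<sigma> = L * (L * Pt - E2)"
    by (simp add: \<sigma>_def sigma_series_def L_def Pt_def)
  have dL: "q_deriv L = 0"
    by (simp add: L_def)
  have sigma': "2 * q_deriv \<sigma> = L * (L * q_deriv Pt - q_deriv E2)"
    using arg_cong[OF sigma, of q_deriv] by (simp add: dL)
  have T: "6 * ds * T = 2 * E6 * d4 + 3 * E4 ^ 2 * d6"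
    using ds_nz by (simp add: T_def)
  have T': "6 * (q_deriv ds * T + ds * q_deriv T) = 2 * (q_deriv E6 * d4 + E6 * q_deriv d4)
      + 3 * (2 * E4 * q_deriv E4 * d6 + E4 ^ 2 * q_deriv d6)"
    using arg_cong[OF T, of q_deriv] by (simp add: algebra_simps)
  \<comment> \<open>The premise is derived inside the algebraic identity, where no derivation is
    available; only the passage to its derivative is supplied here.\<close>
  have Qt': "8 * \<sigma> * q_deriv \<sigma> - L ^ 4 * q_deriv Qt + L ^ 2 * q_deriv E4 = 24 * L * q_deriv T"
    if "4 * \<sigma> ^ 2 - L ^ 4 * Qt + L ^ 2 * E4 = 24 * L * T"
    using arg_cong[OF that, of q_deriv] by (simp add: dL algebra_simps)
  have l_pos: "l > 0"
    using l3 by simp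
  have "L ^ 6 * ds ^ 3 * Rt = E6 * ds ^ 3 * L ^ 3
      - (18 * (d6 ^ 2 * dss - 2 * d6 * ds * ds6 + d66 * ds ^ 2) * E4 ^ 4
            + (24 * E6 * d4 * (d6 * dss - ds * ds6)
               + 24 * E6 * ds * (d46 * ds - d6 * ds4)
               + 10 * d4 * ds ^ 2) * E4 ^ 2
            + 3 * ds ^ 2 * (7 * E6 * d6 - \<sigma> * ds) * E4
            + 8 * E6 ^ 2 * (d4 ^ 2 * dss - 2 * d4 * ds * ds4 + d44 * ds ^ 2)) * L ^ 2
      - 12 * ds ^ 2 * \<sigma> * (3 * E4 ^ 2 * d6 + 2 * E6 * d4) * L + 8 * ds ^ 3 * \<sigma> ^ 3"
    by (rule ccr_second_derivative_identity[OF L_nz ds_nz euler sigma sigma'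
          ramanujan_E2 ramanujan_E4 ramanujan_E6
          ramanujan_compose_power[OF l_pos, folded Pt_def Qt_def Rt_def L_def] chain T T' Qt'])
  then show ?thesis
    unfolding Let_def U_def[symmetric] \<sigma>_def[symmetric] L_def[symmetric] Rt_def[symmetric]
    unfolding d_defs[unfolded ev_def, symmetric]
    using L_nz ds_nz by (simp add: field_simps)
qed

end
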